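(* Let $U$ and $V$ be independent standard normal random variables, let $\phi\colon\mathbb{R}\to\mathbb{R}$ be Borel measurable, let $P$ be the continuous inverse regression associated with $\phi$, and let $\Gamma$ be the associated noise traders' expected loss (all defined in the context). If $(\phi,P)$ is an equilibrium in the normalised model, then $$\Gamma=\frac12 .$$
   Context: Set $Y=\phi(V)+U$ and let $\varrho(t)=\frac{1}{\sqrt{2\pi}}e^{-t^2/2}$. The continuous inverse regression $P\colon\mathbb{R}\to\mathbb{R}$ associated with $\phi$ is $$P(y):=\frac{\int_{\mathbb{R}}v\,\varrho(v)\,\varrho(y-\phi(v))\,dv}{\int_{\mathbb{R}}\varrho(v)\,\varrho(y-\phi(v))\,dv},\qquad y\in\mathbb{R}.$$ It satisfies $P(Y)=\mathbb{E}[V\mid Y]$ almost surely, $P(Y)\in L^2$, and $P(x+U)\in L^1$ for every $x\in\mathbb{R}$. The noise traders' expected loss is $$\Gamma:=\mathbb{E}\big[U\,(P(Y)-V)\big],$$ which is well defined and finite. The pair $(\phi,P)$ is an equilibrium in the normalised model (where $V$ and $U$ are independent standard normal) if: (1) for every $v\in\mathbb{R}$, $\phi(v)\in\operatorname*{arg\,max}_{x\in\mathbb{R}}\mathbb{E}[(v-P(x+U))\,x]$; and (2) $P(Y)=\mathbb{E}[V\mid Y]$ almost surely. *)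

theory Defs
  imports "HOL-Probability.Probability"
begin

(* The denominator is positive for every y (and the numerator converges absolutely)
   when phi is Borel measurable, so no division by zero occurs. *)
definition inverse_regression :: "(real \<Rightarrow> real) \<Rightarrow> real \<Rightarrow> real" where
  "inverse_regression \<phi> y =
     (\<integral>v. v * std_normal_density v * std_normal_density (y - \<phi> v) \<partial>lborel) /
     (\<integral>v. std_normal_density v * std_normal_density (y - \<phi> v) \<partial>lborel)"

definition order_flow ::
  "('a \<Rightarrow> real) \<Rightarrow> ('a \<Rightarrow> real) \<Rightarrow> (real \<Rightarrow> real) \<Rightarrow> 'a \<Rightarrow> real" where
  "order_flow U V \<phi> \<omega> = \<phi> (V \<omega>) + U \<omega>"

definition noise_loss ::
  "'a measure \<Rightarrow> ('a \<Rightarrow> real) \<Rightarrow> ('a \<Rightarrow> real) \<Rightarrow> (real \<Rightarrow> real) \<Rightarrow> (real \<Rightarrow> real) \<Rightarrow> real" where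
  "noise_loss M U V \<phi> P = (\<integral>\<omega>. U \<omega> * (P (order_flow U V \<phi> \<omega>) - V \<omega>) \<partial>M)"

(* The conditional expectation given Y is taken with respect to the sigma-algebra on
   space M generated by Y. For P the inverse regression, P (x + U) is integrable for
   every x, so the expectations in the first clause are genuine ones. *)
definition equilibrium ::
  "'a measure \<Rightarrow> ('a \<Rightarrow> real) \<Rightarrow> ('a \<Rightarrow> real) \<Rightarrow> (real \<Rightarrow> real) \<Rightarrow> (real \<Rightarrow> real) \<Rightarrow> bool" where
  "equilibrium M U V \<phi> P \<longleftrightarrow>
     (\<forall>v. is_arg_max (\<lambda>x. \<integral>\<omega>. (v - P (x + U \<omega>)) * x \<partial>M) (\<lambda>x. x \<in> UNIV) (\<phi> v)) \<and>
     (AE \<omega> in M. P (order_flow U V \<phi> \<omega>) =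
        real_cond_exp M (vimage_algebra (space M) (order_flow U V \<phi>) borel) V \<omega>)"

end

theory Submission
  imports Defs
begin

text \<open>
The noise traders' loss \<open>\<Gamma>\<close> equals $E[U P(Y)]$, where $Y = \phi(V) + U$, because \<open>U\<close> and \<open>V\<close> are
uncorrelated. It is bounded by 1/2 from both sides.

The upper bound comes from the market maker, for whom $P(Y) = E[V \mid Y]$: expanding
$E[(U + V - 2P(Y))^2] \ge 0$ gives $2 - 4\Gamma \ge 0$ (lemma \<open>noise_loss_le_half\<close>).

The lower bound comes from the insider. Let $H(x) = E[P(x + U)]$ be the expected price and
$W(v) = \max_x (v - H(x))\,x$ the profit of the insider who knows \<open>v\<close>. This is a nonnegative convex
function with subgradient $W' = \phi$, and \<open>\<Gamma>\<close> is the mean of two quantities attached to it: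

\<^item> $\Gamma = E[W(V)]$, since the market maker breaks even and the losses of the noise traders are
  the profits of the insider (lemma \<open>insider_profit_eq_noise_loss\<close>).

\<^item> $\Gamma = E[H'(\phi(V))] = E[W(V)/W'(V)^2]$, since $H'(x) = E[U P(x + U)]$ by Gaussian integration
  by parts and the first order condition $v - H(\phi(v)) = \phi(v) H'(\phi(v))$ says that
  $W = \phi^2\, H'(\phi)$ (lemma \<open>optimal_order_first_order_condition\<close>).

For every such convex function, $E[W(V)] + E[W(V)/W'(V)^2] \ge 1$ when \<open>V\<close> is standard normal (lemma
\<open>gaussian_convex_inequality\<close>). Writing $W = r^2/2$ turns the second mean into
$\frac12 E[1/r'(V)^2]$, and the inequality follows from $1/t^2 \ge 3 - 2t$ and the integration by parts
$E[r'(V)] \le E[V r(V)] \le \frac12 + \frac12 E[r(V)^2]$. Hence $2\Gamma \ge 1$.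

No regularity of \<open>\<phi>\<close> is available beyond measurability, so the derivative of \<open>r\<close> is replaced by
difference quotients, integrability of \<open>\<phi>(V)\<close> by truncation, and differentiability of \<open>H\<close> is derived from
a growth bound on \<open>P\<close> (lemma \<open>inverse_regression_growth\<close>).
\<close>

section \<open>Gaussian integrals and translations\<close>

lemma integrable_mult_of_squares:
  fixes f g :: "'a \<Rightarrow> real"
  assumes [measurable]: "f \<in> borel_measurable M" "g \<in> borel_measurable M"
    and "integrable M (\<lambda>x. (f x)\<^sup>2)" "integrable M (\<lambda>x. (g x)\<^sup>2)"
  shows "integrable M (\<lambda>x. f x * g x)"
proof (rule Bochner_Integration.integrable_bound)
  show "integrable M (\<lambda>x. (f x)\<^sup>2 + (g x)\<^sup>2)" using assms by simp
  show "AE x in M. norm (f x * g x) \<le> norm ((f x)\<^sup>2 + (g x)\<^sup>2)"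
  proof (intro AE_I2)
    fix x
    have "2 * (\<bar>f x\<bar> * \<bar>g x\<bar>) \<le> (f x)\<^sup>2 + (g x)\<^sup>2"
      using sum_squares_bound[of "\<bar>f x\<bar>" "\<bar>g x\<bar>"] by (simp add: mult.assoc)
    moreover have "0 \<le> \<bar>f x\<bar> * \<bar>g x\<bar>" by simp
    ultimately have "\<bar>f x\<bar> * \<bar>g x\<bar> \<le> (f x)\<^sup>2 + (g x)\<^sup>2" by linarith
    then show "norm (f x * g x) \<le> norm ((f x)\<^sup>2 + (g x)\<^sup>2)" by (simp add: abs_mult)
  qed
qed simp

definition gauss :: "real measure" where
  "gauss = density lborel std_normal_density"

lemma sets_gauss [simp, measurable_cong]: "sets gauss = sets borel"
  and space_gauss [simp]: "space gauss = UNIV"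
  by (simp_all add: gauss_def)

interpretation gauss: prob_space gauss
  unfolding gauss_def by (rule prob_space_normal_density) simp

lemma measure_gauss_UNIV [simp]: "measure gauss UNIV = 1"
  using gauss.prob_space by simp

lemma integrable_gauss_iff:
  fixes f :: "real \<Rightarrow> real"
  assumes "f \<in> borel_measurable borel"
  shows "integrable gauss f \<longleftrightarrow> integrable lborel (\<lambda>x. std_normal_density x * f x)"
  using assms by (simp add: gauss_def integrable_density)

lemma integral_gauss:
  fixes f :: "real \<Rightarrow> real"
  assumes "f \<in> borel_measurable borel"
  shows "(\<integral>x. f x \<partial>gauss) = (\<integral>x. std_normal_density x * f x \<partial>lborel)"
  using assms by (simp add: gauss_def integral_density)

lemma gauss_second_moment:
  "integrable gauss (\<lambda>x. x\<^sup>2)" "(\<integral>x. x\<^sup>2 \<partial>gauss) = 1"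
  using integrable_std_normal_moment[of 2] integral_std_normal_moment_even[of 1]
  by (simp_all add: integrable_gauss_iff integral_gauss fact_numeral)

lemma gauss_first_moment:
  "integrable gauss (\<lambda>x. x)" "(\<integral>x. x \<partial>gauss) = 0"
  using integrable_std_normal_moment[of 1] integral_std_normal_moment_odd[of 0]
  by (simp_all add: integrable_gauss_iff integral_gauss)

lemma gauss_AE_neq: "AE x in gauss. x \<noteq> c"
  unfolding gauss_def by (subst AE_density) (auto intro: AE_mp[OF AE_lborel_singleton[of c]])

lemma std_normal_density_shift:
  "std_normal_density (h + x) * exp (h * (h + x) - h\<^sup>2 / 2) = std_normal_density x"
  by (simp add: std_normal_density_def mult_exp_exp power2_eq_square field_simps)

lemma integrable_gauss_exp_abs: "integrable gauss (\<lambda>u. exp (c * \<bar>u\<bar>))"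
proof -
  have 1: "integrable gauss (\<lambda>u. exp (b * u))" for b :: real
  proof -
    have "std_normal_density u * exp (b * u) = exp (b\<^sup>2 / 2) * normal_density b 1 u" for u
      by (simp add: normal_density_def mult_exp_exp power2_eq_square field_simps)
    then show ?thesis by (simp add: integrable_gauss_iff)
  qed
  show ?thesis
  proof (rule Bochner_Integration.integrable_bound)
    show "integrable gauss (\<lambda>u. exp (c * u) + exp ((-c) * u))"
      by (intro Bochner_Integration.integrable_add 1)
    show "AE u in gauss. norm (exp (c * \<bar>u\<bar>)) \<le> norm (exp (c * u) + exp ((- c) * u))"
    proof (intro AE_I2)
      fix u :: real
      have "exp (c * \<bar>u\<bar>) \<le> exp (c * u) + exp ((- c) * u)"
        by (cases "u \<ge> 0") (auto simp: abs_if)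
      then show "norm (exp (c * \<bar>u\<bar>)) \<le> norm (exp (c * u) + exp ((- c) * u))" by simp
    qed
  qed simp
qed

text \<open>The Cameron--Martin formula in dimension one: translating the argument costs the density ratio of
the translated Gaussian.\<close>
lemma gauss_shift:
  fixes g :: "real \<Rightarrow> real"
  assumes [measurable]: "g \<in> borel_measurable borel"
  shows "integrable gauss (\<lambda>u. g (u + h)) \<longleftrightarrow> integrable gauss (\<lambda>u. g u * exp (h * u - h\<^sup>2 / 2))"
    and "(\<integral>u. g (u + h) \<partial>gauss) = (\<integral>u. g u * exp (h * u - h\<^sup>2 / 2) \<partial>gauss)"
proof -
  let ?f = "\<lambda>u. std_normal_density u * (g u * exp (h * u - h\<^sup>2 / 2))"
  have eq: "?f (h + 1 * u) = std_normal_density u * g (u + h)" for u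
    using std_normal_density_shift[of h u] by (simp add: ac_simps)
  show "integrable gauss (\<lambda>u. g (u + h)) \<longleftrightarrow> integrable gauss (\<lambda>u. g u * exp (h * u - h\<^sup>2 / 2))"
    using lborel_integrable_real_affine_iff[of 1 ?f h] unfolding eq by (simp add: integrable_gauss_iff)
  show "(\<integral>u. g (u + h) \<partial>gauss) = (\<integral>u. g u * exp (h * u - h\<^sup>2 / 2) \<partial>gauss)"
    using lborel_integral_real_affine[of 1 ?f h] unfolding eq by (simp add: integral_gauss)
qed

lemma integrable_gauss_mult_exp:
  fixes g :: "real \<Rightarrow> real"
  assumes [measurable]: "g \<in> borel_measurable borel" and sq: "integrable gauss (\<lambda>u. (g u)\<^sup>2)"
    and [measurable]: "w \<in> borel_measurable borel" and w: "\<And>u. \<bar>w u\<bar> \<le> exp (c * \<bar>u\<bar> + d)"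
  shows "integrable gauss (\<lambda>u. g u * w u)"
proof (rule integrable_mult_of_squares[OF _ _ sq])
  show "integrable gauss (\<lambda>u. (w u)\<^sup>2)"
  proof (rule Bochner_Integration.integrable_bound)
    show "integrable gauss (\<lambda>u. exp (2 * d) * exp (2 * c * \<bar>u\<bar>))"
      by (intro integrable_mult_right integrable_gauss_exp_abs)
    show "AE u in gauss. norm ((w u)\<^sup>2) \<le> norm (exp (2 * d) * exp (2 * c * \<bar>u\<bar>))"
    proof (intro AE_I2)
      fix u
      have "(w u)\<^sup>2 \<le> (exp (c * \<bar>u\<bar> + d))\<^sup>2"
        using power_mono[OF w[of u] abs_ge_zero, of 2] by simp
      also have "(exp (c * \<bar>u\<bar> + d))\<^sup>2 = exp (2 * d) * exp (2 * c * \<bar>u\<bar>)"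
        by (simp add: power2_eq_square mult_exp_exp algebra_simps)
      finally show "norm ((w u)\<^sup>2) \<le> norm (exp (2 * d) * exp (2 * c * \<bar>u\<bar>))" by simp
    qed
  qed simp
qed simp_all

lemma abs_exp_minus_one_le: "\<bar>exp s - 1\<bar> \<le> \<bar>s\<bar> * exp \<bar>s\<bar>" for s :: real
proof (cases "s \<ge> 0")
  case True
  have "(1 - s) * exp s \<le> exp (- s) * exp s"
    using exp_ge_add_one_self[of "-s"] by (intro mult_right_mono) auto
  then have "exp s - 1 \<le> s * exp s" by (simp add: mult_exp_exp algebra_simps)
  then show ?thesis using True by simp
next
  case False
  have "1 - exp s \<le> - s" using exp_ge_add_one_self[of s] by linarith
  also have "- s \<le> - s * exp (- s)" using False by simp
  finally show ?thesis using False by simp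
qed

text \<open>Gaussian integration by parts, with the derivative taken outside the integral. The difference
quotients of $h \mapsto \int g(u + h)$ are integrals of $g$ itself against the difference quotients
of the Cameron--Martin density, so the formula survives jumps of \<open>g\<close>. The limit serves twice: it differentiates the
expected price, and it evaluates the limiting mean difference quotient of a function with jumps.\<close>
lemma gauss_translation_derivative:
  fixes g :: "real \<Rightarrow> real" and h :: "nat \<Rightarrow> real"
  assumes [measurable]: "g \<in> borel_measurable borel" and sq: "integrable gauss (\<lambda>u. (g u)\<^sup>2)"
    and h: "h \<longlonglongrightarrow> 0" "\<And>n. h n \<noteq> 0" "\<And>n. \<bar>h n\<bar> \<le> 1"
  shows "integrable gauss (\<lambda>u. u * g u)"
    and "\<And>n. integrable gauss (\<lambda>u. g (u + h n))"
    and "(\<lambda>n. ((\<integral>u. g (u + h n) \<partial>gauss) - (\<integral>u. g u \<partial>gauss)) / h n) \<longlonglongrightarrow> (\<integral>u. u * g u \<partial>gauss)"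
proof -
  \<comment> \<open>The difference quotient of the Cameron--Martin density; it tends to \<open>u\<close> and stays below
      an exponential because every shift is at most 1 in absolute value.\<close>
  define q where "q n u = (exp (h n * u - (h n)\<^sup>2 / 2) - 1) / h n" for n u
  have q_meas [measurable]: "q n \<in> borel_measurable borel" for n
    unfolding q_def by measurable
  have expo: "\<bar>h n * u - (h n)\<^sup>2 / 2\<bar> \<le> \<bar>h n\<bar> * (\<bar>u\<bar> + 1 / 2)" for n u
  proof -
    have "\<bar>h n * u - (h n)\<^sup>2 / 2\<bar> \<le> \<bar>h n\<bar> * \<bar>u\<bar> + \<bar>h n\<bar> * \<bar>h n\<bar> / 2"
      by (rule order_trans[OF abs_triangle_ineq4]) (simp add: abs_mult power2_eq_square)
    also have "\<bar>h n\<bar> * \<bar>h n\<bar> \<le> \<bar>h n\<bar> * 1"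
      by (intro mult_left_mono h) auto
    finally show ?thesis by (simp add: algebra_simps)
  qed
  have expo1: "\<bar>h n * u - (h n)\<^sup>2 / 2\<bar> \<le> \<bar>u\<bar> + 1 / 2" for n u
    using order_trans[OF expo[of n u]] mult_right_mono[OF h(3)[of n], of "\<bar>u\<bar> + 1 / 2"] by simp
  have q_bound: "\<bar>q n u\<bar> \<le> exp (2 * \<bar>u\<bar> + 1)" for n u
  proof -
    have "\<bar>exp (h n * u - (h n)\<^sup>2 / 2) - 1\<bar> \<le> \<bar>h n\<bar> * (\<bar>u\<bar> + 1 / 2) * exp (\<bar>u\<bar> + 1 / 2)"
      by (rule order_trans[OF abs_exp_minus_one_le])
         (intro mult_mono expo, use expo1[of n u] in auto)
    then have "\<bar>q n u\<bar> \<le> (\<bar>u\<bar> + 1 / 2) * exp (\<bar>u\<bar> + 1 / 2)"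
      using h(2)[of n] by (simp add: q_def abs_divide divide_le_eq ac_simps)
    also have "\<dots> \<le> exp (\<bar>u\<bar> + 1 / 2) * exp (\<bar>u\<bar> + 1 / 2)"
      using exp_ge_add_one_self[of "\<bar>u\<bar> + 1 / 2"] by (intro mult_right_mono) auto
    also have "\<dots> = exp (2 * \<bar>u\<bar> + 1)" by (simp add: mult_exp_exp)
    finally show ?thesis .
  qed
  have q_lim: "(\<lambda>n. q n u) \<longlonglongrightarrow> u" for u
  proof -
    have "((\<lambda>t. exp (t * u - t\<^sup>2 / 2)) has_field_derivative u) (at 0)"
      by (auto intro!: derivative_eq_intros)
    then have "((\<lambda>t. (exp (t * u - t\<^sup>2 / 2) - 1) / t) \<longlongrightarrow> u) (at 0)"
      by (simp add: has_field_derivative_iff)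
    moreover have "filterlim h (at 0) sequentially"
      using h by (simp add: filterlim_at)
    ultimately show ?thesis
      unfolding q_def by (rule filterlim_compose)
  qed
  show int_ug: "integrable gauss (\<lambda>u. u * g u)"
  proof -
    have "\<bar>u\<bar> \<le> exp \<bar>u\<bar>" for u :: real
      using exp_ge_add_one_self[of "\<bar>u\<bar>"] by linarith
    then have "integrable gauss (\<lambda>u. g u * u)"
      by (intro integrable_gauss_mult_exp[where c=1 and d=0] sq) auto
    then show ?thesis by (simp add: mult.commute)
  qed
  have int_e: "integrable gauss (\<lambda>u. g u * exp (h n * u - (h n)\<^sup>2 / 2))" for n
    by (rule integrable_gauss_mult_exp[where c=1 and d="1/2"])
       (use expo1[of n] sq in \<open>auto simp: abs_le_iff\<close>)
  then show int_s: "integrable gauss (\<lambda>u. g (u + h n))" for n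
    by (simp add: gauss_shift)
  have int_g: "integrable gauss g"
    using integrable_gauss_mult_exp[of g "\<lambda>u. 1" 0 0] sq by simp
  have "((\<integral>u. g (u + h n) \<partial>gauss) - (\<integral>u. g u \<partial>gauss)) / h n = (\<integral>u. g u * q n u \<partial>gauss)" for n
  proof -
    have "(\<integral>u. g u * q n u \<partial>gauss) = (\<integral>u. (g u * exp (h n * u - (h n)\<^sup>2 / 2) - g u) / h n \<partial>gauss)"
      by (intro Bochner_Integration.integral_cong) (auto simp: q_def algebra_simps diff_divide_distrib)
    then show ?thesis
      using int_e[of n] int_g by (simp add: gauss_shift)
  qed
  moreover have "(\<lambda>n. \<integral>u. g u * q n u \<partial>gauss) \<longlonglongrightarrow> (\<integral>u. g u * u \<partial>gauss)"
  proof (rule integral_dominated_convergence)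
    show "integrable gauss (\<lambda>u. \<bar>g u * exp (2 * \<bar>u\<bar> + 1)\<bar>)"
      by (intro integrable_abs integrable_gauss_mult_exp[where c=2 and d=1]) (use sq in auto)
    show "AE u in gauss. (\<lambda>n. g u * q n u) \<longlonglongrightarrow> g u * u"
      by (intro AE_I2 tendsto_intros q_lim)
    show "AE u in gauss. norm (g u * q n u) \<le> \<bar>g u * exp (2 * \<bar>u\<bar> + 1)\<bar>" for n
      using q_bound[of n] by (intro AE_I2) (simp add: abs_mult mult_left_mono)
  qed simp_all
  ultimately show "(\<lambda>n. ((\<integral>u. g (u + h n) \<partial>gauss) - (\<integral>u. g u \<partial>gauss)) / h n) \<longlonglongrightarrow> (\<integral>u. u * g u \<partial>gauss)"
    by (simp add: mult.commute)
qed

section \<open>An inequality for convex functions of a Gaussian variable\<close>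

text \<open>A quantitative form of "the square root \<open>r\<close> of $2w$ has slope at least $p / r = 1 / \sqrt{2a}$
where $w$ has slope at least $p$ and $w = p^2 a$". The slope \<open>1/q\<close> is measured at the far end of the
step, where $q^2 = 2a + 2e/p$, and then $3 - 2/q \le q^2$ is the tangent-line bound of
$t \mapsto 1/t^2$ at $t = 1$. The alternative 3 in the minimum keeps the error term integrable where
\<open>p\<close> is small.\<close>
lemma sqrt_increment_bound:
  fixes p e a w w' :: real
  assumes "p > 0" "e > 0" "a \<ge> 0" and w: "w = p\<^sup>2 * a" and w': "w' \<ge> w + e * p"
  shows "3 - 2 * ((sqrt (2 * w') - sqrt (2 * w)) / e) \<le> 2 * a + min 3 (2 * e / p)"
proof -
  define q where "q = sqrt (2 * a + 2 * e / p)"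
  define z where "z = sqrt (2 * a)"
  define d where "d = (sqrt (2 * w') - sqrt (2 * w)) / e"
  have q2: "q\<^sup>2 = 2 * a + 2 * e / p" using assms by (simp add: q_def)
  have q: "q > 0" using assms by (simp add: q_def add_nonneg_pos)
  have z: "0 \<le> z" "z \<le> q" "z\<^sup>2 = 2 * a" using assms by (simp_all add: z_def q_def)
  have "2 * w + 2 * (e * p) = p\<^sup>2 * q\<^sup>2"
    unfolding q2 w using assms by (simp add: power2_eq_square field_simps)
  then have "sqrt (2 * w') \<ge> sqrt (p\<^sup>2 * q\<^sup>2)"
    using w' by (intro real_sqrt_le_mono) linarith
  then have "sqrt (2 * w') \<ge> p * q"
    using q assms by (simp add: real_sqrt_mult)
  moreover have "sqrt (2 * w) = p * z"
    unfolding w z_def using assms by (simp add: real_sqrt_mult)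
  ultimately have "d \<ge> (p * q - p * z) / e"
    unfolding d_def using assms by (intro divide_right_mono) auto
  moreover have "(p * q - p * z) / e \<ge> 1 / q"
  proof -
    have "p * (q - z) * (q + z) = p * (q\<^sup>2 - z\<^sup>2)" by (simp add: power2_eq_square algebra_simps)
    also have "\<dots> = 2 * e" unfolding q2 z using assms by simp
    finally have "2 * e = p * (q - z) * (q + z)" ..
    also have "\<dots> \<le> p * (q - z) * (2 * q)"
      using z q assms by (intro mult_left_mono) auto
    finally have "e \<le> p * (q - z) * q" by simp
    then show ?thesis using q assms by (simp add: field_simps)
  qed
  ultimately have d: "d \<ge> 1 / q" by linarith
  then have d0: "d \<ge> 0"
    using q by (meson divide_nonneg_pos order_trans zero_le_one)
  \<comment> \<open>The cubic \<open>q^3 - 3 q + 2\<close> has a double root at 1.\<close>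
  have "0 \<le> (q - 1)\<^sup>2 * (q + 2)" using q by simp
  then have "3 * q - 2 \<le> q\<^sup>2 * q" by (simp add: power2_eq_square algebra_simps)
  then have "3 - 2 * (1 / q) \<le> q\<^sup>2" using q by (simp add: field_simps)
  with d have "3 - 2 * d \<le> q\<^sup>2" by linarith
  moreover have "3 - 2 * d \<le> 2 * a + 3" using d0 assms by linarith
  ultimately show "3 - 2 * ((sqrt (2 * w') - sqrt (2 * w)) / e) \<le> 2 * a + min 3 (2 * e / p)"
    unfolding q2 d_def[symmetric] by (simp add: min_def)
qed

text \<open>Here \<open>W\<close> is convex with subgradient \<open>\<phi>\<close>, and \<open>a\<close> is $W / W'^2$. Put
$r = \mathrm{sgn}(\phi) \sqrt{2W}$, so that $r' = 1/\sqrt{2a}$. Then $2a = 1/r'^2 \ge 3 - 2r'$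
pointwise, while integration by parts gives $\int r' \le \int v\,r(v) \le \frac12(1 + \int r^2)$.
Adding up, $2\int a \ge 3 - (1 + 2\int W)$. Equality forces $r(v) = v$, that is $W(v) = v^2/2$.

The derivative of \<open>r\<close> has to be read through difference quotients, since \<open>\<phi>\<close> may jump and \<open>r\<close>
jumps upwards when \<open>\<phi>\<close> jumps across 0. To this end \<open>r\<close> is split into its positive part, with forward difference quotients, and its negative part,
with backward ones: in these directions the subgradient inequality bounds the quotient from below.\<close>
lemma gaussian_convex_inequality:
  fixes W \<phi> a :: "real \<Rightarrow> real"
  assumes [measurable]: "W \<in> borel_measurable borel" "\<phi> \<in> borel_measurable borel"
    and W_nonneg: "\<And>v. 0 \<le> W v"
    and subgrad: "\<And>v v'. W v + \<phi> v * (v' - v) \<le> W v'"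
    and W_eq: "\<And>v. W v = (\<phi> v)\<^sup>2 * a v"
    and nz: "AE v in gauss. \<phi> v \<noteq> 0"
    and intW: "integrable gauss W" and inta: "integrable gauss a"
  shows "1 \<le> (\<integral>v. W v \<partial>gauss) + (\<integral>v. a v \<partial>gauss)"
proof -
  define rp where "rp v = (if \<phi> v > 0 then sqrt (2 * W v) else 0)" for v
  define rm where "rm v = (if \<phi> v < 0 then sqrt (2 * W v) else 0)" for v
  define e where "e n = 1 / real (Suc n)" for n
  have [measurable]: "rp \<in> borel_measurable borel" "rm \<in> borel_measurable borel"
    unfolding rp_def rm_def by measurable
  have rp_sq: "(rp v)\<^sup>2 + (rm v)\<^sup>2 \<le> 2 * W v" and r0: "rp v \<ge> 0" "rm v \<ge> 0" "rp v * rm v = 0" for v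
    using W_nonneg[of v] by (auto simp: rp_def rm_def)
  have sqp: "integrable gauss (\<lambda>v. (rp v)\<^sup>2)" and sqm: "integrable gauss (\<lambda>v. (rm v)\<^sup>2)"
    by (rule Bochner_Integration.integrable_bound[OF integrable_mult_right[OF intW, of 2]];
        use W_nonneg in \<open>auto simp: rp_def rm_def\<close>)+
  have e: "e n > 0" "e n \<noteq> 0" "\<bar>e n\<bar> \<le> 1" "e \<longlonglongrightarrow> 0" for n
    using LIMSEQ_inverse_real_of_nat by (auto simp: e_def[abs_def] inverse_eq_divide)
  have e': "(\<lambda>n. - e n) \<longlonglongrightarrow> 0" using tendsto_minus[OF e(4)] by simp
  note P = gauss_translation_derivative[where g=rp and h=e, OF _ sqp e(4) e(2,3)]
  note Q = gauss_translation_derivative[where g=rm and h="\<lambda>n. - e n", OF _ sqm e']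
  have intp: "integrable gauss rp" and intm: "integrable gauss rm"
    using integrable_gauss_mult_exp[of rp "\<lambda>u. 1" 0 0] integrable_gauss_mult_exp[of rm "\<lambda>u. 1" 0 0] sqp sqm
    by simp_all
  have mono: "\<phi> v \<le> \<phi> v'" if "v < v'" for v v'
  proof -
    have "(\<phi> v' - \<phi> v) * (v' - v) \<ge> 0" using subgrad[of v v'] subgrad[of v' v] by (simp add: algebra_simps)
    then show ?thesis using that by (simp add: zero_le_mult_iff)
  qed
  \<comment> \<open>The forward quotient of the positive part plus the backward quotient of the negative part.
      Both are nonnegative, and wherever \<open>\<phi>\<close> is nonzero one of them is a quotient of the square root of \<open>2 W\<close>.\<close>
  define D where "D n v = (rp (v + e n) - rp v) / e n + (rm (v + - e n) - rm v) / e n" for n v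
  have add_nonneg: "3 - 2 * (d + c) \<le> R" "3 - 2 * (c + d) \<le> R" if "3 - 2 * d \<le> R" "0 \<le> c" for c d R :: real
    using that by auto
  have pt: "3 - 2 * D n v \<le> 2 * a v + min 3 (2 * e n / \<bar>\<phi> v\<bar>)" if "\<phi> v \<noteq> 0" for n v
  proof -
    have a: "a v \<ge> 0" using W_nonneg[of v] that unfolding W_eq by (simp add: zero_le_mult_iff)
    show ?thesis
    proof (cases "\<phi> v > 0")
      case True
      have "\<phi> (v + e n) > 0" using mono[of v "v + e n"] e(1)[of n] True by simp
      then have r: "rp v = sqrt (2 * W v)" "rp (v + e n) = sqrt (2 * W (v + e n))" "rm v = 0"
        using True by (simp_all add: rp_def rm_def)
      have "W (v + e n) \<ge> W v + e n * \<phi> v" using subgrad[of v "v + e n"] by (simp add: mult.commute)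
      from sqrt_increment_bound[OF True e(1) a W_eq this]
      have "3 - 2 * ((sqrt (2 * W (v + e n)) - sqrt (2 * W v)) / e n) \<le> 2 * a v + min 3 (2 * e n / \<bar>\<phi> v\<bar>)"
        using True by simp
      moreover have "(rm (v + - e n) - rm v) / e n \<ge> 0"
        unfolding r using r0(2) e(1)[of n] by simp
      ultimately show ?thesis unfolding D_def r by (rule add_nonneg)
    next
      case False
      then have neg: "- \<phi> v > 0" using that by simp
      have "\<phi> (v + - e n) < 0" using mono[of "v + - e n" v] e(1)[of n] neg by simp
      then have r: "rm v = sqrt (2 * W v)" "rm (v + - e n) = sqrt (2 * W (v + - e n))" "rp v = 0"
        using neg by (simp_all add: rp_def rm_def)
      have "W (v + - e n) \<ge> W v + e n * (- \<phi> v)" using subgrad[of v "v + - e n"] by (simp add: mult.commute)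
      from sqrt_increment_bound[OF neg e(1) a _ this] W_eq[of v]
      have "3 - 2 * ((sqrt (2 * W (v + - e n)) - sqrt (2 * W v)) / e n) \<le> 2 * a v + min 3 (2 * e n / \<bar>\<phi> v\<bar>)"
        using neg by simp
      moreover have "(rp (v + e n) - rp v) / e n \<ge> 0"
        unfolding r using r0(1) e(1)[of n] by simp
      ultimately show ?thesis unfolding D_def r by (rule add_nonneg)
    qed
  qed
  have intD: "integrable gauss (D n)" for n
    unfolding D_def using P(2)[of n] Q(2)[of n] intp intm e by simp
  have D_lim: "(\<lambda>n. \<integral>v. D n v \<partial>gauss) \<longlonglongrightarrow> (\<integral>v. v * rp v \<partial>gauss) - (\<integral>v. v * rm v \<partial>gauss)"
  proof -
    have "(\<integral>v. D n v \<partial>gauss) = ((\<integral>v. rp (v + e n) \<partial>gauss) - (\<integral>v. rp v \<partial>gauss)) / e n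
        - ((\<integral>v. rm (v + - e n) \<partial>gauss) - (\<integral>v. rm v \<partial>gauss)) / - e n" for n
      unfolding D_def using P(2)[of n] Q(2)[of n] intp intm e by simp
    then show ?thesis using tendsto_diff[OF P(3) Q(3)] e by simp
  qed
  \<comment> \<open>The accumulated error of the pointwise bounds, which vanishes by dominated convergence.\<close>
  define b where "b n = (\<integral>v. min 3 (2 * e n / \<bar>\<phi> v\<bar>) \<partial>gauss)" for n
  have intb: "integrable gauss (\<lambda>v. min 3 (2 * e n / \<bar>\<phi> v\<bar>))" for n
    by (rule gauss.integrable_const_bound[where B=3]) (use e(1)[of n] in auto)
  have b_lim: "b \<longlonglongrightarrow> (\<integral>v. 0 \<partial>gauss)"
    unfolding b_def
  proof (rule integral_dominated_convergence[where w="\<lambda>_. 3"])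
    have "(\<lambda>n. min 3 (2 * e n / \<bar>\<phi> v\<bar>)) \<longlonglongrightarrow> min 3 (2 * 0 / \<bar>\<phi> v\<bar>)" if "\<phi> v \<noteq> 0" for v
      using that by (intro tendsto_intros e) auto
    then show "AE v in gauss. (\<lambda>n. min 3 (2 * e n / \<bar>\<phi> v\<bar>)) \<longlonglongrightarrow> 0"
      using nz by auto
    show "AE v in gauss. norm (min 3 (2 * e n / \<bar>\<phi> v\<bar>)) \<le> 3" for n
      using e(1)[of n] by (intro AE_I2) auto
  qed simp_all
  have "3 - 2 * (\<integral>v. D n v \<partial>gauss) \<le> 2 * (\<integral>v. a v \<partial>gauss) + b n" for n
  proof -
    have "(\<integral>v. 3 - 2 * D n v \<partial>gauss) \<le> (\<integral>v. 2 * a v + min 3 (2 * e n / \<bar>\<phi> v\<bar>) \<partial>gauss)"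
      using nz pt by (intro integral_mono_AE) (use intD inta intb in auto)
    then show ?thesis using intD[of n] inta intb[of n] by (simp add: b_def)
  qed
  then have 1: "3 - 2 * ((\<integral>v. v * rp v \<partial>gauss) - (\<integral>v. v * rm v \<partial>gauss)) \<le> 2 * (\<integral>v. a v \<partial>gauss) + (\<integral>v. 0 \<partial>gauss)"
    by (intro LIMSEQ_le[OF tendsto_diff[OF tendsto_const tendsto_mult[OF tendsto_const D_lim]]
          tendsto_add[OF tendsto_const b_lim]]) auto
  have "2 * ((\<integral>v. v * rp v \<partial>gauss) - (\<integral>v. v * rm v \<partial>gauss)) = (\<integral>v. 2 * (v * rp v - v * rm v) \<partial>gauss)"
    using P(1) Q(1) e by simp
  also have "\<dots> \<le> (\<integral>v. v\<^sup>2 + 2 * W v \<partial>gauss)"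
  proof (rule integral_mono)
    fix v
    have "2 * v * (rp v - rm v) \<le> v\<^sup>2 + (rp v - rm v)\<^sup>2" by (rule sum_squares_bound)
    also have "(rp v - rm v)\<^sup>2 \<le> 2 * W v" using rp_sq[of v] r0(3)[of v] by (auto simp: power2_diff)
    finally show "2 * (v * rp v - v * rm v) \<le> v\<^sup>2 + 2 * W v" by (simp add: algebra_simps)
  qed (use P(1) Q(1) e intW gauss_second_moment in auto)
  also have "\<dots> = 1 + 2 * (\<integral>v. W v \<partial>gauss)" using intW gauss_second_moment by simp
  finally show ?thesis using 1 by simp
qed

section \<open>Growth of the inverse regression\<close>

lemma std_normal_density_le_one: "std_normal_density x \<le> 1"
proof -
  have "1 \<le> sqrt (2 * pi)" using pi_gt3 by simp
  then have "1 / sqrt (2 * pi) \<le> 1" by simp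
  moreover have "exp (- x\<^sup>2 / 2) \<le> 1" by simp
  ultimately show ?thesis
    unfolding std_normal_density_def by (intro mult_le_one) auto
qed

lemma inverse_regression_gauss:
  assumes [measurable]: "\<phi> \<in> borel_measurable borel"
  shows "inverse_regression \<phi> y =
    (\<integral>v. v * std_normal_density (y - \<phi> v) \<partial>gauss) / (\<integral>v. std_normal_density (y - \<phi> v) \<partial>gauss)"
  by (simp add: inverse_regression_def integral_gauss ac_simps)

lemma inverse_regression_measurable [measurable]:
  assumes [measurable]: "\<phi> \<in> borel_measurable borel"
  shows "inverse_regression \<phi> \<in> borel_measurable borel"
  unfolding inverse_regression_def[abs_def] by measurable

text \<open>Under the posterior of \<open>v\<close> given \<open>y\<close>, the bound $|v| \le L + e^{|v| - L}$ gives
$|P(y)| \le L + e^{-L}\,C / f(y)$, where $f$ is the denominator of the regression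
and $C = E[e^{|V|}]$. As some interval
$[-K, K]$ carries more than half of the law of $\phi(V)$, $f(y)$ is at least a constant times
$e^{-(|y| + K)^2/2}$. Choosing $L = (|y| + K)^2/2$ makes the second term bounded, so \<open>P\<close> grows at
most quadratically. The cruder exponential bound is convenient because it turns translations of the
argument into constant factors.\<close>
lemma inverse_regression_growth:
  assumes [measurable]: "\<phi> \<in> borel_measurable borel"
  shows "\<exists>B. \<forall>y. \<bar>inverse_regression \<phi> y\<bar> \<le> B * exp \<bar>y\<bar>"
proof -
  define A where "A n = {v. \<bar>\<phi> v\<bar> \<le> real n}" for n
  have [measurable]: "A n \<in> sets borel" for n unfolding A_def by measurable
  have "(\<lambda>n. measure gauss (A n)) \<longlonglongrightarrow> measure gauss (\<Union>n. A n)"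
    by (rule gauss.finite_Lim_measure_incseq) (auto simp: A_def incseq_def)
  moreover have "(\<Union>n. A n) = space gauss"
    using real_arch_simple by (auto simp: A_def)
  ultimately have "(\<lambda>n. measure gauss (A n)) \<longlonglongrightarrow> 1"
    by (simp del: UN_simps)
  then have "eventually (\<lambda>n. measure gauss (A n) > 1 / 2) sequentially"
    by (rule order_tendstoD) simp
  then obtain n where n: "measure gauss (A n) > 1 / 2"
    by (auto simp: eventually_sequentially)
  define K where "K = real n"
  define C where "C = (\<integral>v. exp (1 * \<bar>v\<bar>) \<partial>gauss)"
  have C: "C \<ge> 0" unfolding C_def by simp
  define B where "B = exp K + 2 * sqrt (2 * pi) * C"
  have "\<bar>inverse_regression \<phi> y\<bar> \<le> B * exp \<bar>y\<bar>" for y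
  proof -
    define L where "L = (\<bar>y\<bar> + K)\<^sup>2 / 2"
    define s where "s v = std_normal_density (y - \<phi> v)" for v
    have [measurable]: "s \<in> borel_measurable borel" unfolding s_def by measurable
    have s: "0 \<le> s v" "s v \<le> 1" for v unfolding s_def by (auto simp: std_normal_density_le_one)
    have int_s: "integrable gauss s"
      by (rule gauss.integrable_const_bound[where B=1]) (use s in auto)
    define f where "f = (\<integral>v. s v \<partial>gauss)"
    have L0: "L \<ge> 0" by (simp add: L_def)
    have f_low: "exp (- L) / sqrt (2 * pi) / 2 \<le> f"
    proof -
      have low: "exp (- L) / sqrt (2 * pi) * indicator (A n) v \<le> s v" for v
      proof (cases "v \<in> A n")
        case True
        then have "\<bar>y - \<phi> v\<bar> \<le> \<bar>y\<bar> + K" by (auto simp: A_def K_def)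
        then have "(y - \<phi> v)\<^sup>2 \<le> (\<bar>y\<bar> + K)\<^sup>2"
          by (metis abs_ge_zero power2_abs power_mono)
        then show ?thesis using True
          by (simp add: s_def std_normal_density_def L_def divide_right_mono)
      qed (use s in simp)
      have "exp (- L) / sqrt (2 * pi) / 2 \<le> exp (- L) / sqrt (2 * pi) * measure gauss (A n)"
        using mult_left_mono[of "1/2" "measure gauss (A n)" "exp (- L) / sqrt (2 * pi)"] n by simp
      also have "\<dots> = (\<integral>v. exp (- L) / sqrt (2 * pi) * indicator (A n) v \<partial>gauss)"
        by simp
      also have "\<dots> \<le> f"
        unfolding f_def by (intro integral_mono int_s low) (auto intro!: gauss.integrable_const_bound[where B="exp (- L) / sqrt (2 * pi)"] simp: indicator_def)
      finally show ?thesis .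
    qed
    then have f: "f > 0"
      by (rule less_le_trans[rotated]) simp
    have bnd: "\<bar>v\<bar> * s v \<le> L * s v + exp (- L) * exp (1 * \<bar>v\<bar>)" for v
    proof -
      have "\<bar>v\<bar> \<le> L + exp (\<bar>v\<bar> - L)" using exp_ge_add_one_self[of "\<bar>v\<bar> - L"] by linarith
      then have "\<bar>v\<bar> * s v \<le> (L + exp (\<bar>v\<bar> - L)) * s v" using s by (intro mult_right_mono)
      also have "\<dots> = L * s v + exp (\<bar>v\<bar> - L) * s v" by (simp add: algebra_simps)
      also have "exp (\<bar>v\<bar> - L) * s v \<le> exp (\<bar>v\<bar> - L) * 1" using s by (intro mult_left_mono) auto
      finally show ?thesis by (simp add: mult_exp_exp)
    qed
    have int_b: "integrable gauss (\<lambda>v. L * s v + exp (- L) * exp (1 * \<bar>v\<bar>))"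
      using int_s integrable_gauss_exp_abs[of 1] by simp
    have int_vs: "integrable gauss (\<lambda>v. \<bar>v\<bar> * s v)"
      by (rule Bochner_Integration.integrable_bound[OF int_b])
         (use bnd s L0 in \<open>auto intro!: AE_I2 simp: abs_mult\<close>)
    have "\<bar>\<integral>v. v * s v \<partial>gauss\<bar> \<le> (\<integral>v. \<bar>v * s v\<bar> \<partial>gauss)" by (rule integral_abs_bound)
    also have "\<dots> = (\<integral>v. \<bar>v\<bar> * s v \<partial>gauss)" using s by (simp add: abs_mult)
    also have "\<dots> \<le> (\<integral>v. L * s v + exp (- L) * exp (1 * \<bar>v\<bar>) \<partial>gauss)"
      by (intro integral_mono int_vs int_b bnd)
    also have "\<dots> = L * f + exp (- L) * C"
      using int_s integrable_gauss_exp_abs[of 1] by (simp add: f_def C_def)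
    also have "exp (- L) * C \<le> (2 * sqrt (2 * pi) * f) * C"
      using f_low C by (intro mult_right_mono) (simp_all add: field_simps)
    finally have "\<bar>\<integral>v. v * s v \<partial>gauss\<bar> \<le> (L + 2 * sqrt (2 * pi) * C) * f" by (simp add: algebra_simps)
    then have "\<bar>inverse_regression \<phi> y\<bar> \<le> L + 2 * sqrt (2 * pi) * C"
      using f by (simp add: inverse_regression_gauss s_def[symmetric] f_def[symmetric] abs_divide divide_le_eq)
    also have "L \<le> exp (\<bar>y\<bar> + K)"
      using exp_lower_Taylor_quadratic[of "\<bar>y\<bar> + K"] by (simp add: L_def K_def)
    also have "exp (\<bar>y\<bar> + K) + 2 * sqrt (2 * pi) * C \<le> exp K * exp \<bar>y\<bar> + 2 * sqrt (2 * pi) * C * exp \<bar>y\<bar>"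
      using C mult_left_mono[of 1 "exp \<bar>y\<bar>" "2 * sqrt (2 * pi) * C"] by (simp add: mult_exp_exp add.commute)
    finally show ?thesis by (simp add: B_def algebra_simps)
  qed
  then show ?thesis by blast
qed

lemma inverse_regression_translate_square_integrable:
  assumes [measurable]: "\<phi> \<in> borel_measurable borel"
  shows "integrable gauss (\<lambda>u. (inverse_regression \<phi> (u + x))\<^sup>2)"
proof -
  obtain B where B: "\<bar>inverse_regression \<phi> y\<bar> \<le> B * exp \<bar>y\<bar>" for y
    using inverse_regression_growth[OF assms] by blast
  show ?thesis
  proof (rule Bochner_Integration.integrable_bound)
    show "integrable gauss (\<lambda>u. B\<^sup>2 * exp (2 * \<bar>x\<bar>) * exp (2 * \<bar>u\<bar>))"
      by (intro integrable_mult_right integrable_gauss_exp_abs)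
    show "AE u in gauss. norm ((inverse_regression \<phi> (u + x))\<^sup>2) \<le> norm (B\<^sup>2 * exp (2 * \<bar>x\<bar>) * exp (2 * \<bar>u\<bar>))"
    proof (intro AE_I2)
      fix u
      have B0: "0 \<le> B" using order_trans[OF abs_ge_zero B[of 0]] by simp
      have "\<bar>inverse_regression \<phi> (u + x)\<bar> \<le> B * exp (\<bar>u\<bar> + \<bar>x\<bar>)"
        by (rule order_trans[OF B]) (intro mult_left_mono B0, simp)
      then have "\<bar>inverse_regression \<phi> (u + x)\<bar>\<^sup>2 \<le> (B * exp (\<bar>u\<bar> + \<bar>x\<bar>))\<^sup>2"
        by (intro power_mono) auto
      also have "(B * exp (\<bar>u\<bar> + \<bar>x\<bar>))\<^sup>2 = B\<^sup>2 * exp (2 * \<bar>x\<bar>) * exp (2 * \<bar>u\<bar>)"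
        unfolding power_mult_distrib exp_add exp_double by (simp add: mult.commute)
      finally show "norm ((inverse_regression \<phi> (u + x))\<^sup>2) \<le> norm (B\<^sup>2 * exp (2 * \<bar>x\<bar>) * exp (2 * \<bar>u\<bar>))"
        by simp
    qed
  qed simp
qed

section \<open>Two bounds for the expected loss\<close>

interpretation gg: pair_prob_space gauss gauss ..

text \<open>The first coordinate stands for the value \<open>v\<close> of the asset, the second for the noise \<open>u\<close>.\<close>
abbreviation gauss2 :: "(real \<times> real) measure" where
  "gauss2 \<equiv> gauss \<Otimes>\<^sub>M gauss"

lemma gauss2_product:
  fixes f g :: "real \<Rightarrow> real"
  assumes f: "integrable gauss f" and g: "integrable gauss g"
  shows "integrable gauss2 (\<lambda>z. f (fst z) * g (snd z))"
    and "(\<integral>z. f (fst z) * g (snd z) \<partial>gauss2) = (\<integral>x. f x \<partial>gauss) * (\<integral>x. g x \<partial>gauss)"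
proof -
  have [measurable]: "f \<in> borel_measurable borel" "g \<in> borel_measurable borel"
    using assms[THEN borel_measurable_integrable] by auto
  show *: "integrable gauss2 (\<lambda>z. f (fst z) * g (snd z))"
    by (rule gg.Fubini_integrable) (use assms in \<open>auto simp: abs_mult\<close>)
  show "(\<integral>z. f (fst z) * g (snd z) \<partial>gauss2) = (\<integral>x. f x \<partial>gauss) * (\<integral>x. g x \<partial>gauss)"
    using gg.integral_fst'[OF *] by simp
qed

lemma gauss2_moments:
  shows "integrable gauss2 (\<lambda>z. (fst z)\<^sup>2)" "(\<integral>z. (fst z)\<^sup>2 \<partial>gauss2) = 1"
    and "integrable gauss2 (\<lambda>z. (snd z)\<^sup>2)" "(\<integral>z. (snd z)\<^sup>2 \<partial>gauss2) = 1"
    and "integrable gauss2 (\<lambda>z. fst z * snd z)" "(\<integral>z. fst z * snd z \<partial>gauss2) = 0"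
  using gauss2_product[of "\<lambda>x. x\<^sup>2" "\<lambda>_. 1"] gauss2_product[of "\<lambda>_. 1" "\<lambda>x. x\<^sup>2"]
    gauss2_product[of "\<lambda>x. x" "\<lambda>x. x"] gauss_second_moment gauss_first_moment
  by simp_all

text \<open>The expected price \<open>H\<close> is differentiable, as a Gaussian average of \<open>P\<close>, with $H' = a$. The condition says
that the derivative of $y \mapsto (v - H(y))\,y$ vanishes at a maximum.\<close>
lemma optimal_order_first_order_condition:
  fixes P :: "real \<Rightarrow> real"
  assumes [measurable]: "P \<in> borel_measurable borel"
    and sq: "\<And>x. integrable gauss (\<lambda>u. (P (u + x))\<^sup>2)"
  defines "H \<equiv> \<lambda>x. \<integral>u. P (u + x) \<partial>gauss" and "a \<equiv> \<lambda>x. \<integral>u. u * P (u + x) \<partial>gauss"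
  assumes opt: "\<And>y. (v - H y) * y \<le> (v - H x) * x"
  shows "v - H x = x * a x"
proof -
  \<comment> \<open>The two signs of \<open>c\<close> are the two one-sided derivatives.\<close>
  have key: "c * (v - H x - x * a x) \<le> 0" if c: "c = 1 \<or> c = -1" for c :: real
  proof -
    define h where "h n = c / real (Suc n)" for n
    have h: "h \<longlonglongrightarrow> 0" "h n \<noteq> 0" "\<bar>h n\<bar> \<le> 1" "c * h n > 0" for n
      using tendsto_mult[OF tendsto_const[of c] LIMSEQ_inverse_real_of_nat] c
      by (auto simp: h_def[abs_def] inverse_eq_divide)
    define q where "q n = (H (x + h n) - H x) / h n" for n
    have q: "q \<longlonglongrightarrow> a x"
      using gauss_translation_derivative(3)[of "\<lambda>u. P (u + x)" h, OF _ sq h(1-3)]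
      by (simp add: q_def[abs_def] H_def a_def ac_simps)
    have H_eq: "H (x + h n) = H x + h n * q n" for n using h(2)[of n] by (simp add: q_def)
    have "c * (v - H x - h n * q n - x * q n) \<le> 0" for n
    proof -
      have "(v - (H x + h n * q n)) * (x + h n) \<le> (v - H x) * x"
        using opt[of "x + h n"] by (simp add: H_eq)
      then have "h n * (v - H x - h n * q n - x * q n) \<le> 0" by (simp add: algebra_simps)
      moreover have "c = c * h n / h n" using h(2)[of n] by simp
      ultimately show ?thesis using h(4)[of n] c
        by (auto simp: mult_le_0_iff zero_less_mult_iff)
    qed
    moreover have "(\<lambda>n. c * (v - H x - h n * q n - x * q n)) \<longlonglongrightarrow> c * (v - H x - 0 * a x - x * a x)"
      by (intro tendsto_intros q h)
    ultimately show ?thesis by (intro LIMSEQ_le_const2[where X="\<lambda>n. c * (v - H x - h n * q n - x * q n)"]) auto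
  qed
  from key[of 1] key[of "-1"] show ?thesis by simp
qed

lemma clamp_limit: "(\<lambda>n. max (- real n) (min (real n) x)) \<longlonglongrightarrow> x"
proof (rule tendsto_eventually)
  obtain N where "\<bar>x\<bar> \<le> real N" using real_arch_simple by blast
  then show "eventually (\<lambda>n. max (- real n) (min (real n) x) = x) sequentially"
    by (intro eventually_sequentiallyI[of N]) auto
qed

text \<open>The market maker breaks even, so what the noise traders lose the insider gains. Formally,
$E[(V - P(Y))\,Y] = 0$ with $Y = \phi(V) + U$ would give
$E[(V - P(Y))\,\phi(V)] = -E[(V - P(Y))\,U] = E[U P(Y)]$, but nothing guarantees a priori that \<open>\<phi>(V)\<close>
is integrable. Testing with the truncation $k_n(Y)$ in place of $Y$ avoids this: the difference
$k_n(Y) - k_n(\phi(V))$ is dominated by $|U|$, and the remaining term increases to the profit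
because the profit of each type is nonnegative.\<close>
lemma insider_profit_eq_noise_loss:
  fixes P \<phi> :: "real \<Rightarrow> real"
  assumes [measurable]: "P \<in> borel_measurable borel" "\<phi> \<in> borel_measurable borel"
    and P_sq: "integrable gauss2 (\<lambda>z. (P (\<phi> (fst z) + snd z))\<^sup>2)"
    and P_int: "\<And>x. integrable gauss (\<lambda>u. P (u + x))"
    and bayes: "\<And>k. k \<in> borel_measurable borel \<Longrightarrow> bounded (range k) \<Longrightarrow>
      (\<integral>z. (fst z - P (\<phi> (fst z) + snd z)) * k (\<phi> (fst z) + snd z) \<partial>gauss2) = 0"
  defines "H \<equiv> \<lambda>x. \<integral>u. P (u + x) \<partial>gauss"
  assumes W_nonneg: "\<And>v. 0 \<le> (v - H (\<phi> v)) * \<phi> v"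
  shows "integrable gauss (\<lambda>v. (v - H (\<phi> v)) * \<phi> v)"
    and "(\<integral>v. (v - H (\<phi> v)) * \<phi> v \<partial>gauss) = (\<integral>z. snd z * P (\<phi> (fst z) + snd z) \<partial>gauss2)"
proof -
  let ?Y = "\<lambda>z. \<phi> (fst z) + snd z"
  define R where "R z = fst z - P (?Y z)" for z
  define k where "k n y = max (- real n) (min (real n) y)" for n and y :: real
  have [measurable]: "R \<in> borel_measurable gauss2" "k n \<in> borel_measurable borel" for n
    unfolding R_def k_def by measurable
  have [measurable]: "H \<in> borel_measurable borel" unfolding H_def by measurable
  have k_lip: "\<bar>k n x - k n y\<bar> \<le> \<bar>x - y\<bar>" and k_bound: "\<bar>k n x\<bar> \<le> real n" for n x y
    by (auto simp: k_def)
  have k_lim: "(\<lambda>n. k n x) \<longlonglongrightarrow> x" for x unfolding k_def by (rule clamp_limit)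
  have uP: "integrable gauss2 (\<lambda>z. snd z * P (?Y z))"
    by (rule integrable_mult_of_squares) (use P_sq gauss2_moments in auto)
  have Ru: "integrable gauss2 (\<lambda>z. R z * snd z)"
    using gauss2_moments(5) uP by (simp add: R_def algebra_simps)
  have R1: "integrable gauss2 R"
    unfolding R_def using integrable_mult_of_squares[of fst gauss2 "\<lambda>_. 1"]
      integrable_mult_of_squares[of "\<lambda>z. P (?Y z)" gauss2 "\<lambda>_. 1"] gauss2_moments(1) P_sq
    by simp
  have Rk: "integrable gauss2 (\<lambda>z. R z * k n (w z))" if [measurable]: "w \<in> borel_measurable gauss2" for n w
    by (rule Bochner_Integration.integrable_bound[OF integrable_mult_right[OF R1, of "real n"]])
       (use k_bound in \<open>auto intro!: AE_I2 mult_mono simp: abs_mult mult.commute[of "\<bar>R _\<bar>"]\<close>)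
  have "(\<lambda>n. \<integral>z. R z * (k n (?Y z) - k n (\<phi> (fst z))) \<partial>gauss2) \<longlonglongrightarrow> (\<integral>z. R z * (?Y z - \<phi> (fst z)) \<partial>gauss2)"
  proof (rule integral_dominated_convergence)
    show "integrable gauss2 (\<lambda>z. \<bar>R z * snd z\<bar>)" using Ru by simp
    show "AE z in gauss2. (\<lambda>n. R z * (k n (?Y z) - k n (\<phi> (fst z)))) \<longlonglongrightarrow> R z * (?Y z - \<phi> (fst z))"
      by (intro AE_I2 tendsto_intros k_lim)
    show "AE z in gauss2. norm (R z * (k n (?Y z) - k n (\<phi> (fst z)))) \<le> \<bar>R z * snd z\<bar>" for n
    proof (intro AE_I2)
      fix z
      have "\<bar>k n (?Y z) - k n (\<phi> (fst z))\<bar> \<le> \<bar>snd z\<bar>" using k_lip[of n "?Y z" "\<phi> (fst z)"] by simp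
      then show "norm (R z * (k n (?Y z) - k n (\<phi> (fst z)))) \<le> \<bar>R z * snd z\<bar>"
        by (simp add: abs_mult mult_left_mono)
    qed
  qed simp_all
  moreover have "(\<integral>z. R z * (k n (?Y z) - k n (\<phi> (fst z))) \<partial>gauss2) = - (\<integral>v. (v - H (\<phi> v)) * k n (\<phi> v) \<partial>gauss)" for n
  proof -
    have "(\<integral>z. R z * k n (?Y z) \<partial>gauss2) = 0"
      unfolding R_def using k_bound[of n] by (intro bayes) (auto simp: bounded_iff)
    moreover have "(\<integral>z. R z * k n (\<phi> (fst z)) \<partial>gauss2) = (\<integral>v. (v - H (\<phi> v)) * k n (\<phi> v) \<partial>gauss)"
      using gg.integral_fst'[OF Rk[of "\<lambda>z. \<phi> (fst z)" n]] P_int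
      by (simp add: R_def H_def add.commute[of "\<phi> _"])
    ultimately show ?thesis
      using Rk[of ?Y n] Rk[of "\<lambda>z. \<phi> (fst z)" n] by (simp add: right_diff_distrib)
  qed
  moreover have "(\<integral>z. R z * (?Y z - \<phi> (fst z)) \<partial>gauss2) = - (\<integral>z. snd z * P (?Y z) \<partial>gauss2)"
  proof -
    have "(\<integral>z. R z * (?Y z - \<phi> (fst z)) \<partial>gauss2) = (\<integral>z. fst z * snd z - snd z * P (?Y z) \<partial>gauss2)"
      by (simp add: R_def algebra_simps)
    then show ?thesis using gauss2_moments uP by simp
  qed
  ultimately have "(\<lambda>n. - (\<integral>v. (v - H (\<phi> v)) * k n (\<phi> v) \<partial>gauss)) \<longlonglongrightarrow> - (\<integral>z. snd z * P (?Y z) \<partial>gauss2)"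
    by simp
  then have lim: "(\<lambda>n. \<integral>v. (v - H (\<phi> v)) * k n (\<phi> v) \<partial>gauss) \<longlonglongrightarrow> (\<integral>z. snd z * P (?Y z) \<partial>gauss2)"
    by (rule tendsto_minus_cancel)
  have int: "integrable gauss (\<lambda>v. (v - H (\<phi> v)) * k n (\<phi> v))" for n
    using gg.integrable_fst'[OF Rk[of "\<lambda>z. \<phi> (fst z)" n]] P_int
    by (simp add: R_def H_def add.commute[of "\<phi> _"])
  have mono: "mono (\<lambda>n. (v - H (\<phi> v)) * k n (\<phi> v))" for v
  proof (rule monoI)
    fix m n :: nat assume "m \<le> n"
    then have "0 \<le> \<phi> v \<Longrightarrow> k m (\<phi> v) \<le> k n (\<phi> v)" "\<phi> v \<le> 0 \<Longrightarrow> k n (\<phi> v) \<le> k m (\<phi> v)"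
      by (auto simp: k_def min_def max_def)
    moreover have "0 \<le> v - H (\<phi> v) \<and> 0 \<le> \<phi> v \<or> v - H (\<phi> v) \<le> 0 \<and> \<phi> v \<le> 0"
      using W_nonneg[of v] by (simp only: zero_le_mult_iff)
    ultimately show "(v - H (\<phi> v)) * k m (\<phi> v) \<le> (v - H (\<phi> v)) * k n (\<phi> v)"
      by (metis mult_left_mono mult_left_mono_neg)
  qed
  have pos: "0 \<le> (v - H (\<phi> v)) * k n (\<phi> v)" for n v
    using W_nonneg[of v] by (auto simp: k_def zero_le_mult_iff min_def max_def)
  note mc = integral_monotone_convergence_nonneg[where f="\<lambda>n v. (v - H (\<phi> v)) * k n (\<phi> v)" and M=gauss,
      OF int AE_I2[OF mono] AE_I2[OF pos] _ lim]
  show "integrable gauss (\<lambda>v. (v - H (\<phi> v)) * \<phi> v)"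
    by (rule mc) (auto intro!: AE_I2 tendsto_intros k_lim)
  show "(\<integral>v. (v - H (\<phi> v)) * \<phi> v \<partial>gauss) = (\<integral>z. snd z * P (\<phi> (fst z) + snd z) \<partial>gauss2)"
    by (rule mc) (auto intro!: AE_I2 tendsto_intros k_lim)
qed

text \<open>The insider's optimal profit \<open>W\<close>, a supremum of functions affine in \<open>v\<close>, is convex with
subgradient \<open>\<phi>\<close>. The first order condition makes the ratio $W/W'^2$ equal to $a(\phi(v)) =
E[U P(\phi(v) + U)]$, whose mean is the noise traders' loss; the mean of \<open>W\<close> is the same
loss by the break-even condition. Hence the inequality for convex functions bounds twice the loss from below
by 1.\<close>
lemma noise_loss_ge_half:
  fixes P \<phi> :: "real \<Rightarrow> real"
  assumes [measurable]: "P \<in> borel_measurable borel" "\<phi> \<in> borel_measurable borel"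
    and P_sq: "integrable gauss2 (\<lambda>z. (P (\<phi> (fst z) + snd z))\<^sup>2)"
    and sq: "\<And>x. integrable gauss (\<lambda>u. (P (u + x))\<^sup>2)"
    and bayes: "\<And>k. k \<in> borel_measurable borel \<Longrightarrow> bounded (range k) \<Longrightarrow>
      (\<integral>z. (fst z - P (\<phi> (fst z) + snd z)) * k (\<phi> (fst z) + snd z) \<partial>gauss2) = 0"
    and opt: "\<And>v x. (v - (\<integral>u. P (u + x) \<partial>gauss)) * x \<le> (v - (\<integral>u. P (u + \<phi> v) \<partial>gauss)) * \<phi> v"
  shows "1 / 2 \<le> (\<integral>z. snd z * P (\<phi> (fst z) + snd z) \<partial>gauss2)"
proof -
  let ?Y = "\<lambda>z. \<phi> (fst z) + snd z"
  define H where "H x = (\<integral>u. P (u + x) \<partial>gauss)" for x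
  define a where "a x = (\<integral>u. u * P (u + x) \<partial>gauss)" for x
  define W where "W v = (v - H (\<phi> v)) * \<phi> v" for v
  have [measurable]: "H \<in> borel_measurable borel" unfolding H_def by measurable
  have [measurable]: "W \<in> borel_measurable borel" unfolding W_def by measurable
  have P_int: "integrable gauss (\<lambda>u. P (u + x))" for x
    using integrable_mult_of_squares[of "\<lambda>u. P (u + x)" gauss "\<lambda>_. 1"] sq by simp
  have opt': "(v - H x) * x \<le> W v" for v x using opt by (simp add: W_def H_def)
  have W_nonneg: "0 \<le> W v" for v using opt'[of v 0] by simp
  have foc: "v - H (\<phi> v) = \<phi> v * a (\<phi> v)" for v
    using optimal_order_first_order_condition[of P v "\<phi> v", OF _ sq] opt[of v]
    by (simp add: H_def a_def)
  note profit = insider_profit_eq_noise_loss[OF assms(1,2) P_sq P_int bayes, folded H_def, folded W_def, OF _ _ W_nonneg]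
  have uP: "integrable gauss2 (\<lambda>z. snd z * P (?Y z))"
    by (rule integrable_mult_of_squares) (use P_sq gauss2_moments in auto)
  have inta: "integrable gauss (\<lambda>v. a (\<phi> v))"
    using gg.integrable_fst'[OF uP] by (simp add: a_def add.commute)
  have a_eq: "(\<integral>v. a (\<phi> v) \<partial>gauss) = (\<integral>z. snd z * P (?Y z) \<partial>gauss2)"
    using gg.integral_fst'[OF uP] by (simp add: a_def add.commute)
  have "1 \<le> (\<integral>v. W v \<partial>gauss) + (\<integral>v. a (\<phi> v) \<partial>gauss)"
  proof (rule gaussian_convex_inequality[of W \<phi>])
    show "W v + \<phi> v * (v' - v) \<le> W v'" for v v'
      using opt'[of v' "\<phi> v"] by (simp add: W_def algebra_simps)
    show "W v = (\<phi> v)\<^sup>2 * a (\<phi> v)" for v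
      unfolding W_def foc by (simp add: power2_eq_square)
    \<comment> \<open>The first order condition recovers the value from the order, so only one value leads to the order 0.\<close>
    have "\<phi> v = 0 \<Longrightarrow> v = H 0" for v using foc[of v] by simp
    then show "AE v in gauss. \<phi> v \<noteq> 0"
      using gauss_AE_neq[of "H 0"] by (auto elim: eventually_mono)
  qed (use W_nonneg profit inta in auto)
  then show ?thesis using profit(2) a_eq by simp
qed

text \<open>With $Q$ the projection of $V$ on the order flow, $E[VQ] = E[Q^2]$, and expanding
$0 \le E[(U + V - 2Q)^2]$ leaves $2 - 4\,E[UQ]$. For the strategy $\phi(v) = v$ one has $Q = (U + V)/2$ and the square
vanishes.\<close>
lemma noise_loss_le_half:
  fixes Q :: "real \<times> real \<Rightarrow> real"
  assumes [measurable]: "Q \<in> borel_measurable gauss2" and Q_sq: "integrable gauss2 (\<lambda>z. (Q z)\<^sup>2)"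
    and proj: "(\<integral>z. fst z * Q z \<partial>gauss2) = (\<integral>z. (Q z)\<^sup>2 \<partial>gauss2)"
  shows "(\<integral>z. snd z * Q z \<partial>gauss2) \<le> 1 / 2"
proof -
  have iu: "integrable gauss2 (\<lambda>z. snd z * Q z)" and iv: "integrable gauss2 (\<lambda>z. fst z * Q z)"
    by (rule integrable_mult_of_squares; use Q_sq gauss2_moments in auto)+
  have "0 \<le> (\<integral>z. (fst z + snd z - 2 * Q z)\<^sup>2 \<partial>gauss2)" by simp
  also have "\<dots> = (\<integral>z. (fst z)\<^sup>2 + (snd z)\<^sup>2 + 2 * (fst z * snd z) + 4 * (Q z)\<^sup>2
      - 4 * (fst z * Q z) - 4 * (snd z * Q z) \<partial>gauss2)"
    by (simp add: power2_eq_square algebra_simps)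
  also have "\<dots> = 2 - 4 * (\<integral>z. snd z * Q z \<partial>gauss2)"
    using iu iv Q_sq gauss2_moments proj by simp
  finally show ?thesis by simp
qed

section \<open>The loss in equilibrium\<close>

theorem proposition6p1:
  fixes M :: "'a measure" and U V :: "'a \<Rightarrow> real" and \<phi> :: "real \<Rightarrow> real"
  assumes "prob_space M"
    and "distributed M lborel U std_normal_density"
    and "distributed M lborel V std_normal_density"
    and "prob_space.indep_var M borel U borel V"
    and "\<phi> \<in> borel_measurable borel"
    and "equilibrium M U V \<phi> (inverse_regression \<phi>)"
  shows "noise_loss M U V \<phi> (inverse_regression \<phi>) = 1 / 2"
proof -
  interpret prob_space M by fact
  define P where "P = inverse_regression \<phi>"
  define Y where "Y = order_flow U V \<phi>"
  define F where "F = vimage_algebra (space M) Y borel"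
  let ?Q = "\<lambda>z. P (\<phi> (fst z) + snd z)"
  note [measurable] = \<open>\<phi> \<in> borel_measurable borel\<close>
  have P_meas [measurable]: "P \<in> borel_measurable borel"
    unfolding P_def by measurable
  have UV [measurable]: "U \<in> borel_measurable M" "V \<in> borel_measurable M"
    using assms(2,3)[THEN distributed_measurable] by simp_all
  have Y_meas [measurable]: "Y \<in> borel_measurable M"
    unfolding Y_def order_flow_def[abs_def] by measurable

  have dU: "distr M borel U = gauss"
    using distributed_distr_eq_density[OF assms(2)]
    by (simp add: gauss_def cong: distr_cong)
  have dV: "distr M borel V = gauss"
    using distributed_distr_eq_density[OF assms(3)]
    by (simp add: gauss_def cong: distr_cong)
  have joint: "distr M (borel \<Otimes>\<^sub>M borel) (\<lambda>\<omega>. (V \<omega>, U \<omega>)) = gauss2"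
  proof -
    have UV_joint: "distr M (borel \<Otimes>\<^sub>M borel) (\<lambda>\<omega>. (U \<omega>, V \<omega>)) = gauss2"
      using assms(4) by (simp add: indep_var_distribution_eq dU dV)
    have "gauss2 = distr gauss2 gauss2 (\<lambda>(x, y). (y, x))"
      by (rule gg.distr_pair_swap)
    also have "\<dots> = distr (distr M (borel \<Otimes>\<^sub>M borel) (\<lambda>\<omega>. (U \<omega>, V \<omega>))) gauss2 (\<lambda>(x, y). (y, x))"
      by (simp only: UV_joint)
    also have "\<dots> = distr M gauss2 ((\<lambda>(x, y). (y, x)) \<circ> (\<lambda>\<omega>. (U \<omega>, V \<omega>)))"
      by (rule distr_distr) measurable
    also have "\<dots> = distr M (borel \<Otimes>\<^sub>M borel) (\<lambda>\<omega>. (V \<omega>, U \<omega>))"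
      by (rule distr_cong) (auto intro!: sets_pair_measure_cong)
    finally show ?thesis ..
  qed
  have law: "integrable M (\<lambda>\<omega>. f (V \<omega>, U \<omega>)) \<longleftrightarrow> integrable gauss2 f"
    "(\<integral>\<omega>. f (V \<omega>, U \<omega>) \<partial>M) = (\<integral>z. f z \<partial>gauss2)"
    if [measurable]: "f \<in> borel_measurable gauss2" for f :: "real \<times> real \<Rightarrow> real"
    unfolding joint[symmetric] by (simp_all add: integrable_distr_eq integral_distr)

  have V_sq: "integrable M (\<lambda>\<omega>. (V \<omega>)\<^sup>2)"
    using law(1)[of "\<lambda>z. (fst z)\<^sup>2"] gauss2_moments by simp
  have V_int: "integrable M V"
    using integrable_mult_of_squares[of V M "\<lambda>_. 1"] V_sq by simp

  interpret F: finite_measure_subalgebra M F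
    by unfold_locales
       (auto simp: subalgebra_def F_def sets_vimage_algebra2 intro: measurable_sets[OF Y_meas])
  have Y_F [measurable]: "Y \<in> borel_measurable F"
    unfolding F_def by (rule measurable_vimage_algebra1) simp
  have cond: "AE \<omega> in M. P (Y \<omega>) = real_cond_exp M F V \<omega>"
    using assms(6) by (simp add: equilibrium_def P_def Y_def F_def)

  have PY_sq: "integrable M (\<lambda>\<omega>. (P (Y \<omega>))\<^sup>2)"
  proof -
    have "integrable M (\<lambda>\<omega>. (real_cond_exp M F V \<omega>)\<^sup>2)"
      by (rule F.integrable_convex_cond_exp[where I=UNIV and q="\<lambda>x. x\<^sup>2"])
         (use V_int V_sq in \<open>auto intro: convex_power2\<close>)
    then show ?thesis
      by (rule integrable_cong_AE_imp) (use cond in \<open>auto\<close>)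
  qed
  have Q_sq: "integrable gauss2 (\<lambda>z. (?Q z)\<^sup>2)"
    using law(1)[of "\<lambda>z. (?Q z)\<^sup>2"] PY_sq by (simp add: Y_def order_flow_def)
  \<comment> \<open>Conditional expectation as orthogonality. Bounded \<open>k\<close> serve the lower bound and
      \<open>k = P\<close>, which may be unbounded, the upper bound.\<close>
  have orth: "(\<integral>z. fst z * k (\<phi> (fst z) + snd z) \<partial>gauss2) = (\<integral>z. ?Q z * k (\<phi> (fst z) + snd z) \<partial>gauss2)"
    if [measurable]: "k \<in> borel_measurable borel"
      and k: "integrable gauss2 (\<lambda>z. fst z * k (\<phi> (fst z) + snd z))" for k
  proof -
    have "integrable M (\<lambda>\<omega>. k (Y \<omega>) * V \<omega>)"
      using law(1)[of "\<lambda>z. fst z * k (\<phi> (fst z) + snd z)"] k by (simp add: Y_def order_flow_def mult.commute)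
    then have "(\<integral>\<omega>. k (Y \<omega>) * real_cond_exp M F V \<omega> \<partial>M) = (\<integral>\<omega>. k (Y \<omega>) * V \<omega> \<partial>M)"
      by (intro F.real_cond_exp_intg) auto
    moreover have "(\<integral>\<omega>. k (Y \<omega>) * real_cond_exp M F V \<omega> \<partial>M) = (\<integral>\<omega>. k (Y \<omega>) * P (Y \<omega>) \<partial>M)"
      by (intro integral_cong_AE) (use cond in auto)
    ultimately show ?thesis
      using law(2)[of "\<lambda>z. fst z * k (\<phi> (fst z) + snd z)"] law(2)[of "\<lambda>z. ?Q z * k (\<phi> (fst z) + snd z)"]
      by (simp add: Y_def order_flow_def mult.commute)
  qed

  have P_sq: "integrable gauss (\<lambda>u. (P (u + x))\<^sup>2)" for x
    unfolding P_def by (rule inverse_regression_translate_square_integrable) fact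
  have P_int: "integrable gauss (\<lambda>u. P (u + x))" for x
    using integrable_mult_of_squares[of "\<lambda>u. P (u + x)" gauss "\<lambda>_. 1"] P_sq by simp
  have price: "(\<integral>\<omega>. (v - P (x + U \<omega>)) * x \<partial>M) = (v - (\<integral>u. P (u + x) \<partial>gauss)) * x" for v x
  proof -
    have "(\<integral>\<omega>. (v - P (x + U \<omega>)) * x \<partial>M) = (\<integral>u. (v - P (u + x)) * x \<partial>gauss)"
      unfolding dU[symmetric] by (simp add: integral_distr add.commute)
    then show ?thesis using P_int[of x] by simp
  qed
  have opt: "(v - (\<integral>u. P (u + x) \<partial>gauss)) * x \<le> (v - (\<integral>u. P (u + \<phi> v) \<partial>gauss)) * \<phi> v" for v x
  proof -
    have "is_arg_max (\<lambda>x. \<integral>\<omega>. (v - P (x + U \<omega>)) * x \<partial>M) (\<lambda>x. x \<in> UNIV) (\<phi> v)"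
      using assms(6) by (simp add: equilibrium_def P_def)
    then show ?thesis unfolding price by (simp add: is_arg_max_linorder)
  qed

  have uQ: "integrable gauss2 (\<lambda>z. snd z * ?Q z)" and vQ: "integrable gauss2 (\<lambda>z. fst z * ?Q z)"
    by (rule integrable_mult_of_squares; use Q_sq gauss2_moments in auto)+
  have "1 / 2 \<le> (\<integral>z. snd z * ?Q z \<partial>gauss2)"
  proof (rule noise_loss_ge_half[OF _ _ Q_sq P_sq _ opt])
    fix k :: "real \<Rightarrow> real" assume [measurable]: "k \<in> borel_measurable borel" and "bounded (range k)"
    then obtain C where C: "\<bar>k y\<bar> \<le> C" for y by (auto simp: bounded_iff)
    have C_sq: "(k y)\<^sup>2 \<le> C\<^sup>2" for y
      using power_mono[OF C[of y] abs_ge_zero, of 2] by simp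
    have "integrable gauss2 (\<lambda>z. (k (\<phi> (fst z) + snd z))\<^sup>2)"
      by (rule gg.integrable_const_bound[where B="C\<^sup>2"])
         (simp_all add: C_sq)
    then have "integrable gauss2 (\<lambda>z. fst z * k (\<phi> (fst z) + snd z))" "integrable gauss2 (\<lambda>z. ?Q z * k (\<phi> (fst z) + snd z))"
      using Q_sq gauss2_moments by (auto intro!: integrable_mult_of_squares)
    then show "(\<integral>z. (fst z - ?Q z) * k (\<phi> (fst z) + snd z) \<partial>gauss2) = 0"
      using orth[of k] by (simp add: left_diff_distrib)
  qed simp_all
  moreover have "(\<integral>z. snd z * ?Q z \<partial>gauss2) \<le> 1 / 2"
    using orth[of P] vQ by (intro noise_loss_le_half Q_sq) (simp_all add: power2_eq_square)
  moreover have "noise_loss M U V \<phi> (inverse_regression \<phi>) = (\<integral>z. snd z * ?Q z \<partial>gauss2)"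
  proof -
    have "noise_loss M U V \<phi> (inverse_regression \<phi>) = (\<integral>z. snd z * (?Q z - fst z) \<partial>gauss2)"
      using law(2)[of "\<lambda>z. snd z * (?Q z - fst z)"]
      by (simp add: noise_loss_def order_flow_def P_def)
    also have "\<dots> = (\<integral>z. snd z * ?Q z - fst z * snd z \<partial>gauss2)"
      by (simp add: algebra_simps)
    finally show ?thesis using uQ gauss2_moments by simp
  qed
  ultimately show ?thesis by simp
qed

end
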